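(* Let $G=(e_X,e_Y,R)$ be a Galois polarity extending the poset $P$. Then: (1) the maps $\iota_X:X\to X\uplus_{\preceq_3}Y$ and $\iota_Y:Y\to X\uplus_{\preceq_3}Y$ are completely meet-preserving and completely join-preserving, respectively; (2) $\preceq_3$ is the only 3-preorder for $G$; (3) $X\uplus_{\preceq_3}Y$ is join-generated by $\iota_X[X]$ and meet-generated by $\iota_Y[Y]$.
   Context: For a poset $Q$ and $q\in Q$, $q^\uparrow=\{r\in Q:r\ge q\}$, $q^\downarrow=\{r\in Q:r\le q\}$. An order embedding $e:P\to Q$ is a meet-extension if $q=\bigwedge e[e^{-1}(q^\uparrow)]$ for all $q\in Q$, and a join-extension if $q=\bigvee e[e^{-1}(q^\downarrow)]$ for all $q\in Q$. An extension polarity is a triple $(e_X,e_Y,R)$ where $P$ is a poset, $X,Y$ disjoint posets, $e_X:P\to X$, $e_Y:P\to Y$ order embeddings, $R\subseteq X\times Y$. It is 3-coherent if: (C1) $x_1\le_X x_2$ and $x_2\mathrel{R}y$ imply $x_1\mathrel{R}y$; (C2) $y_1\le_Y y_2$ and $x\mathrel{R}y_1$ imply $x\mathrel{R}y_2$; (C3) $e_X(p)\mathrel{R}e_Y(p)$ for all $p\in P$; (C4) $x\mathrel{R}e_Y(p)$ and $e_X(p)\mathrel{R}y$ imply $x\mathrel{R}y$; (C5) $x_1\mathrel{R}e_Y(p)$ and $e_X(p)\le_X x_2$ imply $x_1\le_X x_2$; (C6) $y_1\le_Y e_Y(p)$ and $e_X(p)\mathrel{R}y_2$ imply $y_1\le_Y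 y_2$; (C7) if $S\subseteq P$, $\bigwedge e_X[S]=x$ in $X$, $x\mathrel{R}y_2$ and $y_1\le_Y e_Y(p)$ for all $p\in S$, then $y_1\le_Y y_2$; (C8) if $T\subseteq P$, $\bigvee e_Y[T]=y$ in $Y$, $x_1\mathrel{R}y$ and $e_X(q)\le_X x_2$ for all $q\in T$, then $x_1\le_X x_2$. A Galois polarity is a 3-coherent extension polarity in which $e_X$ is a meet-extension and $e_Y$ is a join-extension. For a preorder $\preceq$ on $X\cup Y$, $X\uplus_\preceq Y$ is the quotient poset (identify $z_1,z_2$ when $z_1\preceq z_2\preceq z_1$) and $\iota_X,\iota_Y$ are the inclusions composed with the quotient map. A 3-preorder for the polarity is a preorder $\preceq$ on $X\cup Y$ such that: $x\preceq y\iff x\mathrel{R}y$ for $x\in X,y\in Y$; ${\le_X}\subseteq{\preceq}$, ${\le_Y}\subseteq{\preceq}$; $\iota_X\circ e_X=\iota_Y\circ e_Y$; $\iota_X,\iota_Y$ are order embeddings; for all $S\subseteq P$ such that $\bigwedge e_X[S]$ exists in $X$, $\iota_X(\bigwedge e_X[S])=\bigwedge\iota_X\circ e_X[S]$ in $X\uplus_\preceq Y$; and for all $T\subseteq P$ such that $\bigvee e_Y[T]$ exists in $Y$, $\iota_Y(\bigvee e_Y[T])=\bigvee\iota_Y\circ e_Y[T]$ in $X\uplus_\preceq Y$. $\preceq_3$ is the union of ${\le_X}\cup{\le_Y}\cup R$ with $Z_S=\{(y,x)\in Y\times X:\exists S\subseteq P\,(\bigwedge e_X[S]\text{ exists in }X,\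 \bigwedge e_X[S]\le_X x,\ y\le_Y e_Y(p)\ \forall p\in S)\}$ and $Z_T=\{(y,x)\in Y\times X:\exists T\subseteq P\,(\bigvee e_Y[T]\text{ exists in }Y,\ y\le_Y \bigvee e_Y[T],\ e_X(q)\le_X x\ \forall q\in T)\}$. *)

theory Defs
  imports Main
begin

text \<open>A poset is given by a carrier set \<open>Q\<close> (possibly empty) and a relation \<open>le\<close> with
  \<^term>\<open>partial_order_on Q le\<close>; in particular \<open>le\<close> only relates elements of \<open>Q\<close>.
  The sets \<^term>\<open>above le q\<close> and \<^term>\<open>under le q\<close> are then the principal up-set and
  down-set of \<open>q\<close>.\<close>

definition is_meet :: "'a set \<Rightarrow> 'a rel \<Rightarrow> 'a set \<Rightarrow> 'a \<Rightarrow> bool" where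
  "is_meet Q le S m \<longleftrightarrow>
     m \<in> Q \<and> (\<forall>s\<in>S. (m, s) \<in> le) \<and> (\<forall>z\<in>Q. (\<forall>s\<in>S. (z, s) \<in> le) \<longrightarrow> (z, m) \<in> le)"

definition is_join :: "'a set \<Rightarrow> 'a rel \<Rightarrow> 'a set \<Rightarrow> 'a \<Rightarrow> bool" where
  "is_join Q le S j \<longleftrightarrow>
     j \<in> Q \<and> (\<forall>s\<in>S. (s, j) \<in> le) \<and> (\<forall>z\<in>Q. (\<forall>s\<in>S. (s, z) \<in> le) \<longrightarrow> (j, z) \<in> le)"

definition order_embedding ::
  "'p set \<Rightarrow> 'p rel \<Rightarrow> 'a set \<Rightarrow> 'a rel \<Rightarrow> ('p \<Rightarrow> 'a) \<Rightarrow> bool" where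
  "order_embedding P leP Q leQ e \<longleftrightarrow>
     e ` P \<subseteq> Q \<and> (\<forall>p\<in>P. \<forall>q\<in>P. (p, q) \<in> leP \<longleftrightarrow> (e p, e q) \<in> leQ)"

definition meet_extension ::
  "'p set \<Rightarrow> 'p rel \<Rightarrow> 'a set \<Rightarrow> 'a rel \<Rightarrow> ('p \<Rightarrow> 'a) \<Rightarrow> bool" where
  "meet_extension P leP Q leQ e \<longleftrightarrow>
     order_embedding P leP Q leQ e \<and>
     (\<forall>q\<in>Q. is_meet Q leQ (e ` {p \<in> P. e p \<in> above leQ q}) q)"

definition join_extension ::
  "'p set \<Rightarrow> 'p rel \<Rightarrow> 'a set \<Rightarrow> 'a rel \<Rightarrow> ('p \<Rightarrow> 'a) \<Rightarrow> bool" where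
  "join_extension P leP Q leQ e \<longleftrightarrow>
     order_embedding P leP Q leQ e \<and>
     (\<forall>q\<in>Q. is_join Q leQ (e ` {p \<in> P. e p \<in> under leQ q}) q)"

text \<open>In the following two notions \<open>S\<close> ranges over all subsets, including the empty one.\<close>

definition completely_meet_preserving ::
  "'a set \<Rightarrow> 'a rel \<Rightarrow> 'b set \<Rightarrow> 'b rel \<Rightarrow> ('a \<Rightarrow> 'b) \<Rightarrow> bool" where
  "completely_meet_preserving A leA B leB f \<longleftrightarrow>
     (\<forall>S m. S \<subseteq> A \<longrightarrow> is_meet A leA S m \<longrightarrow> is_meet B leB (f ` S) (f m))"

definition completely_join_preserving ::
  "'a set \<Rightarrow> 'a rel \<Rightarrow> 'b set \<Rightarrow> 'b rel \<Rightarrow> ('a \<Rightarrow> 'b) \<Rightarrow> bool" where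
  "completely_join_preserving A leA B leB f \<longleftrightarrow>
     (\<forall>S j. S \<subseteq> A \<longrightarrow> is_join A leA S j \<longrightarrow> is_join B leB (f ` S) (f j))"

definition join_generated_by :: "'a set \<Rightarrow> 'a rel \<Rightarrow> 'a set \<Rightarrow> bool" where
  "join_generated_by Q le G \<longleftrightarrow> G \<subseteq> Q \<and> (\<forall>q\<in>Q. \<exists>S\<subseteq>G. is_join Q le S q)"

definition meet_generated_by :: "'a set \<Rightarrow> 'a rel \<Rightarrow> 'a set \<Rightarrow> bool" where
  "meet_generated_by Q le G \<longleftrightarrow> G \<subseteq> Q \<and> (\<forall>q\<in>Q. \<exists>S\<subseteq>G. is_meet Q le S q)"

text \<open>The quotient of a preorder \<open>r\<close> on \<open>A\<close>; existence of related representatives is equivalent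
  to all representatives being related, since \<open>r\<close> is transitive.\<close>

definition quot_carrier :: "'a set \<Rightarrow> 'a rel \<Rightarrow> 'a set set" where
  "quot_carrier A r = A // (r \<inter> r\<inverse>)"

definition quot_le :: "'a set \<Rightarrow> 'a rel \<Rightarrow> 'a set rel" where
  "quot_le A r = {(C, D) \<in> quot_carrier A r \<times> quot_carrier A r. \<exists>c\<in>C. \<exists>d\<in>D. (c, d) \<in> r}"

definition quot_map :: "'a rel \<Rightarrow> 'a \<Rightarrow> 'a set" where
  "quot_map r z = (r \<inter> r\<inverse>) `` {z}"

text \<open>The disjoint posets \<open>X\<close> and \<open>Y\<close> share an ambient type, so that \<open>X \<union> Y\<close> can be formed
  literally. The embeddings are total functions whose values outside \<open>P\<close> are irrelevant.\<close>

record ('p, 'a) polarity =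
  Pcar :: "'p set"
  Ple :: "'p rel"
  Xcar :: "'a set"
  Xle :: "'a rel"
  Ycar :: "'a set"
  Yle :: "'a rel"
  eX :: "'p \<Rightarrow> 'a"
  eY :: "'p \<Rightarrow> 'a"
  Rel :: "'a rel"

definition extension_polarity :: "('p, 'a) polarity \<Rightarrow> bool" where
  "extension_polarity G \<longleftrightarrow>
     partial_order_on (Pcar G) (Ple G) \<and>
     partial_order_on (Xcar G) (Xle G) \<and>
     partial_order_on (Ycar G) (Yle G) \<and>
     Xcar G \<inter> Ycar G = {} \<and>
     order_embedding (Pcar G) (Ple G) (Xcar G) (Xle G) (eX G) \<and>
     order_embedding (Pcar G) (Ple G) (Ycar G) (Yle G) (eY G) \<and>
     Rel G \<subseteq> Xcar G \<times> Ycar G"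

definition three_coherent :: "('p, 'a) polarity \<Rightarrow> bool" where
  "three_coherent G \<longleftrightarrow>
     (\<forall>x1\<in>Xcar G. \<forall>x2\<in>Xcar G. \<forall>y\<in>Ycar G.
        (x1, x2) \<in> Xle G \<longrightarrow> (x2, y) \<in> Rel G \<longrightarrow> (x1, y) \<in> Rel G) \<and>
     (\<forall>x\<in>Xcar G. \<forall>y1\<in>Ycar G. \<forall>y2\<in>Ycar G.
        (y1, y2) \<in> Yle G \<longrightarrow> (x, y1) \<in> Rel G \<longrightarrow> (x, y2) \<in> Rel G) \<and>
     (\<forall>p\<in>Pcar G. (eX G p, eY G p) \<in> Rel G) \<and>
     (\<forall>x\<in>Xcar G. \<forall>y\<in>Ycar G. \<forall>p\<in>Pcar G.
        (x, eY G p) \<in> Rel G \<longrightarrow> (eX G p, y) \<in> Rel G \<longrightarrow> (x, y) \<in> Rel G) \<and>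
     (\<forall>x1\<in>Xcar G. \<forall>x2\<in>Xcar G. \<forall>p\<in>Pcar G.
        (x1, eY G p) \<in> Rel G \<longrightarrow> (eX G p, x2) \<in> Xle G \<longrightarrow> (x1, x2) \<in> Xle G) \<and>
     (\<forall>y1\<in>Ycar G. \<forall>y2\<in>Ycar G. \<forall>p\<in>Pcar G.
        (y1, eY G p) \<in> Yle G \<longrightarrow> (eX G p, y2) \<in> Rel G \<longrightarrow> (y1, y2) \<in> Yle G) \<and>
     (\<forall>S x. \<forall>y1\<in>Ycar G. \<forall>y2\<in>Ycar G.
        S \<subseteq> Pcar G \<longrightarrow> is_meet (Xcar G) (Xle G) (eX G ` S) x \<longrightarrow> (x, y2) \<in> Rel G \<longrightarrow>
        (\<forall>p\<in>S. (y1, eY G p) \<in> Yle G) \<longrightarrow> (y1, y2) \<in> Yle G) \<and>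
     (\<forall>T y. \<forall>x1\<in>Xcar G. \<forall>x2\<in>Xcar G.
        T \<subseteq> Pcar G \<longrightarrow> is_join (Ycar G) (Yle G) (eY G ` T) y \<longrightarrow> (x1, y) \<in> Rel G \<longrightarrow>
        (\<forall>q\<in>T. (eX G q, x2) \<in> Xle G) \<longrightarrow> (x1, x2) \<in> Xle G)"

definition galois_polarity :: "('p, 'a) polarity \<Rightarrow> bool" where
  "galois_polarity G \<longleftrightarrow>
     extension_polarity G \<and> three_coherent G \<and>
     meet_extension (Pcar G) (Ple G) (Xcar G) (Xle G) (eX G) \<and>
     join_extension (Pcar G) (Ple G) (Ycar G) (Yle G) (eY G)"

text \<open>The poset \<open>X \<uplus>\<^sub>r Y\<close> has carrier \<open>amalg G r\<close> and order \<open>amalg_le G r\<close>; both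
  canonical maps \<open>\<iota>\<^sub>X\<close>, \<open>\<iota>\<^sub>Y\<close> are restrictions of \<^term>\<open>quot_map r\<close>.\<close>

definition amalg :: "('p, 'a) polarity \<Rightarrow> 'a rel \<Rightarrow> 'a set set" where
  "amalg G r = quot_carrier (Xcar G \<union> Ycar G) r"

definition amalg_le :: "('p, 'a) polarity \<Rightarrow> 'a rel \<Rightarrow> 'a set rel" where
  "amalg_le G r = quot_le (Xcar G \<union> Ycar G) r"

definition three_preorder :: "('p, 'a) polarity \<Rightarrow> 'a rel \<Rightarrow> bool" where
  "three_preorder G r \<longleftrightarrow>
     preorder_on (Xcar G \<union> Ycar G) r \<and>
     (\<forall>x\<in>Xcar G. \<forall>y\<in>Ycar G. (x, y) \<in> r \<longleftrightarrow> (x, y) \<in> Rel G) \<and>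
     Xle G \<subseteq> r \<and> Yle G \<subseteq> r \<and>
     (\<forall>p\<in>Pcar G. quot_map r (eX G p) = quot_map r (eY G p)) \<and>
     order_embedding (Xcar G) (Xle G) (amalg G r) (amalg_le G r) (quot_map r) \<and>
     order_embedding (Ycar G) (Yle G) (amalg G r) (amalg_le G r) (quot_map r) \<and>
     (\<forall>S x. S \<subseteq> Pcar G \<longrightarrow> is_meet (Xcar G) (Xle G) (eX G ` S) x \<longrightarrow>
        is_meet (amalg G r) (amalg_le G r) (quot_map r ` eX G ` S) (quot_map r x)) \<and>
     (\<forall>T y. T \<subseteq> Pcar G \<longrightarrow> is_join (Ycar G) (Yle G) (eY G ` T) y \<longrightarrow>
        is_join (amalg G r) (amalg_le G r) (quot_map r ` eY G ` T) (quot_map r y))"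

definition Z_S :: "('p, 'a) polarity \<Rightarrow> 'a rel" where
  "Z_S G = {(y, x) \<in> Ycar G \<times> Xcar G. \<exists>S m. S \<subseteq> Pcar G \<and>
     is_meet (Xcar G) (Xle G) (eX G ` S) m \<and> (m, x) \<in> Xle G \<and>
     (\<forall>p\<in>S. (y, eY G p) \<in> Yle G)}"

definition Z_T :: "('p, 'a) polarity \<Rightarrow> 'a rel" where
  "Z_T G = {(y, x) \<in> Ycar G \<times> Xcar G. \<exists>T j. T \<subseteq> Pcar G \<and>
     is_join (Ycar G) (Yle G) (eY G ` T) j \<and> (y, j) \<in> Yle G \<and>
     (\<forall>q\<in>T. (eX G q, x) \<in> Xle G)}"

definition preceq3 :: "('p, 'a) polarity \<Rightarrow> 'a rel" where
  "preceq3 G = Xle G \<union> Yle G \<union> Rel G \<union> Z_S G \<union> Z_T G"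

end

theory Submission
  imports Defs
begin

text \<open>Since \<open>e\<^sub>X[P]\<close> is meet-dense in \<open>X\<close> and \<open>e\<^sub>Y[P]\<close> is join-dense in \<open>Y\<close>, both \<open>Z\<^sub>S\<close> and
  \<open>Z\<^sub>T\<close> coincide with the relation ``\<open>e\<^sub>Y(q) \<le> y\<close> and \<open>x \<le> e\<^sub>X(p)\<close> imply \<open>q \<le> p\<close>'', and the \<open>Y \<times> X\<close>
  part of every 3-preorder has to be this relation. Transitivity and the statements on meets and
  joins then reduce to comparisons with the elements of \<open>P\<close>.\<close>

section \<open>Quotients of preorders\<close>

lemma quot_carrier_eq: "quot_carrier A r = quot_map r ` A"
  by (auto simp: quot_carrier_def quot_map_def quotient_def)

lemma quot_le_iff:
  assumes "preorder_on A r" "a \<in> A" "b \<in> A"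
  shows "(quot_map r a, quot_map r b) \<in> quot_le A r \<longleftrightarrow> (a, b) \<in> r"
proof
  assume "(quot_map r a, quot_map r b) \<in> quot_le A r"
  then obtain c d where "(a, c) \<in> r" "(c, d) \<in> r" "(d, b) \<in> r"
    by (auto simp: quot_le_def quot_map_def)
  then show "(a, b) \<in> r"
    using assms(1) by (meson preorder_on_def transE)
next
  assume "(a, b) \<in> r"
  moreover have "a \<in> quot_map r a" "b \<in> quot_map r b"
    using assms by (auto simp: quot_map_def preorder_on_def refl_on_def)
  ultimately show "(quot_map r a, quot_map r b) \<in> quot_le A r"
    using assms by (auto simp: quot_le_def quot_carrier_eq)
qed

lemma quot_map_eqI:
  assumes "trans r" "(a, b) \<in> r" "(b, a) \<in> r"
  shows "quot_map r a = quot_map r b"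
  using assms by (auto simp: quot_map_def dest: transD)

lemma quot_map_eqD:
  assumes "preorder_on A r" "b \<in> A" "quot_map r a = quot_map r b"
  shows "(a, b) \<in> r" "(b, a) \<in> r"
proof -
  have "b \<in> quot_map r b"
    using assms(1,2) by (auto simp: quot_map_def preorder_on_def refl_on_def)
  then have "b \<in> quot_map r a"
    using assms(3) by simp
  then show "(a, b) \<in> r" "(b, a) \<in> r"
    by (auto simp: quot_map_def)
qed

text \<open>Meets in the quotient can thus be computed on representatives in the preorder itself.
  There \<open>is_meet\<close> is applied to a relation that need not be antisymmetric, so it fixes
  a meet only up to equivalence.\<close>

lemma is_meet_quot_iff:
  assumes "preorder_on A r" "S \<subseteq> A" "m \<in> A"
  shows "is_meet (quot_carrier A r) (quot_le A r) (quot_map r ` S) (quot_map r m)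
    \<longleftrightarrow> is_meet A r S m"
  using assms by (simp add: is_meet_def quot_carrier_eq quot_le_iff subset_iff)

lemma is_join_quot_iff:
  assumes "preorder_on A r" "S \<subseteq> A" "m \<in> A"
  shows "is_join (quot_carrier A r) (quot_le A r) (quot_map r ` S) (quot_map r m)
    \<longleftrightarrow> is_join A r S m"
  using assms by (simp add: is_join_def quot_carrier_eq quot_le_iff subset_iff)

section \<open>Galois polarities\<close>

locale galois =
  fixes G :: "('p, 'a) polarity"
  assumes galois_polarity: "galois_polarity G"
begin

abbreviation "P \<equiv> Pcar G"
abbreviation "X \<equiv> Xcar G"
abbreviation "Y \<equiv> Ycar G"
abbreviation "pre \<equiv> preceq3 G"

section \<open>Order, coherence and density facts of a Galois polarity\<close>

lemma disjoint: "x \<in> X \<Longrightarrow> x \<in> Y \<Longrightarrow> False"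
  using galois_polarity by (auto simp: galois_polarity_def extension_polarity_def)

lemma Xle_sub: "(a, b) \<in> Xle G \<Longrightarrow> a \<in> X \<and> b \<in> X"
  and Yle_sub: "(a, b) \<in> Yle G \<Longrightarrow> a \<in> Y \<and> b \<in> Y"
  and Rel_sub: "(a, b) \<in> Rel G \<Longrightarrow> a \<in> X \<and> b \<in> Y"
  using galois_polarity
  by (auto simp: galois_polarity_def extension_polarity_def partial_order_on_def preorder_on_def
      refl_on_def)

lemma Xle_refl: "x \<in> X \<Longrightarrow> (x, x) \<in> Xle G"
  and Yle_refl: "y \<in> Y \<Longrightarrow> (y, y) \<in> Yle G"
  using galois_polarity
  by (auto simp: galois_polarity_def extension_polarity_def partial_order_on_def preorder_on_def
      refl_on_def)

lemma Xle_trans: "(a, b) \<in> Xle G \<Longrightarrow> (b, c) \<in> Xle G \<Longrightarrow> (a, c) \<in> Xle G"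
  and Yle_trans: "(a', b') \<in> Yle G \<Longrightarrow> (b', c') \<in> Yle G \<Longrightarrow> (a', c') \<in> Yle G"
  using galois_polarity
  by (auto simp: galois_polarity_def extension_polarity_def partial_order_on_def preorder_on_def
      dest: transD)

lemma eX_in: "p \<in> P \<Longrightarrow> eX G p \<in> X"
  and eY_in: "p \<in> P \<Longrightarrow> eY G p \<in> Y"
  and eX_iff: "p \<in> P \<Longrightarrow> q \<in> P \<Longrightarrow> (eX G p, eX G q) \<in> Xle G \<longleftrightarrow> (p, q) \<in> Ple G"
  and eY_iff: "p \<in> P \<Longrightarrow> q \<in> P \<Longrightarrow> (eY G p, eY G q) \<in> Yle G \<longleftrightarrow> (p, q) \<in> Ple G"
  using galois_polarity
  by (auto simp: galois_polarity_def extension_polarity_def order_embedding_def)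

text \<open>In this order: (C1), (C2), (C3), (C5), (C6).\<close>

lemma coherent:
  shows "\<forall>x1\<in>X. \<forall>x2\<in>X. \<forall>y\<in>Y. (x1, x2) \<in> Xle G \<longrightarrow> (x2, y) \<in> Rel G \<longrightarrow> (x1, y) \<in> Rel G"
    and "\<forall>x\<in>X. \<forall>y1\<in>Y. \<forall>y2\<in>Y. (y1, y2) \<in> Yle G \<longrightarrow> (x, y1) \<in> Rel G \<longrightarrow> (x, y2) \<in> Rel G"
    and "\<forall>p\<in>P. (eX G p, eY G p) \<in> Rel G"
    and "\<forall>x1\<in>X. \<forall>x2\<in>X. \<forall>p\<in>P.
      (x1, eY G p) \<in> Rel G \<longrightarrow> (eX G p, x2) \<in> Xle G \<longrightarrow> (x1, x2) \<in> Xle G"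
    and "\<forall>y1\<in>Y. \<forall>y2\<in>Y. \<forall>p\<in>P.
      (y1, eY G p) \<in> Yle G \<longrightarrow> (eX G p, y2) \<in> Rel G \<longrightarrow> (y1, y2) \<in> Yle G"
  using galois_polarity unfolding galois_polarity_def three_coherent_def
  by - (elim conjE, assumption)+

lemma Xle_Rel: "(a, b) \<in> Xle G \<Longrightarrow> (b, y) \<in> Rel G \<Longrightarrow> (a, y) \<in> Rel G"
  using coherent(1) Xle_sub Rel_sub by blast

lemma Rel_Yle: "(x, c) \<in> Rel G \<Longrightarrow> (c, d) \<in> Yle G \<Longrightarrow> (x, d) \<in> Rel G"
  using coherent(2) Yle_sub Rel_sub by blast

lemma Rel_eX_eY: "p \<in> P \<Longrightarrow> (eX G p, eY G p) \<in> Rel G"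
  using coherent(3) by blast

text \<open>The case \<open>x2 = eX G p\<close> of (C5). With \<open>Rel_eX_eY\<close> and
  \<open>Xle_Rel\<close> for the converse, R against e_Y(p) amounts to the order of X against
  e_X(p). \<open>Rel_eX_D\<close> is the dual, from (C6).\<close>

lemma Rel_eY_D: "p \<in> P \<Longrightarrow> (x, eY G p) \<in> Rel G \<Longrightarrow> (x, eX G p) \<in> Xle G"
  using coherent(4) Rel_sub eX_in Xle_refl by blast

lemma Rel_eX_D: "p \<in> P \<Longrightarrow> (eX G p, y) \<in> Rel G \<Longrightarrow> (eY G p, y) \<in> Yle G"
  using coherent(5) Rel_sub eY_in Yle_refl by blast

lemma is_meet_eX: "x \<in> X \<Longrightarrow> is_meet X (Xle G) (eX G ` {p \<in> P. (x, eX G p) \<in> Xle G}) x"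
  using galois_polarity by (simp add: galois_polarity_def meet_extension_def above_def)

lemma is_join_eY: "y \<in> Y \<Longrightarrow> is_join Y (Yle G) (eY G ` {q \<in> P. (eY G q, y) \<in> Yle G}) y"
  using galois_polarity by (simp add: galois_polarity_def join_extension_def under_def)

text \<open>A lower bound z of the elements of e_X[P] above x lies below their meet, which is x.
  Comparisons in X are thereby settled by testing against P.\<close>

lemma Xle_dense:
  assumes "z \<in> X" "x \<in> X" "\<And>p. p \<in> P \<Longrightarrow> (x, eX G p) \<in> Xle G \<Longrightarrow> (z, eX G p) \<in> Xle G"
  shows "(z, x) \<in> Xle G"
  using is_meet_eX[OF assms(2)] assms by (auto simp: is_meet_def)

lemma Yle_dense:
  assumes "y \<in> Y" "z \<in> Y" "\<And>q. q \<in> P \<Longrightarrow> (eY G q, y) \<in> Yle G \<Longrightarrow> (eY G q, z) \<in> Yle G"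
  shows "(y, z) \<in> Yle G"
  using is_join_eY[OF assms(1)] assms by (auto simp: is_join_def)

section \<open>The four blocks of \<open>preceq3\<close>\<close>

lemma pre_XX: "a \<in> X \<Longrightarrow> b \<in> X \<Longrightarrow> (a, b) \<in> pre \<longleftrightarrow> (a, b) \<in> Xle G"
  and pre_YY: "c \<in> Y \<Longrightarrow> d \<in> Y \<Longrightarrow> (c, d) \<in> pre \<longleftrightarrow> (c, d) \<in> Yle G"
  and pre_XY: "a \<in> X \<Longrightarrow> c \<in> Y \<Longrightarrow> (a, c) \<in> pre \<longleftrightarrow> (a, c) \<in> Rel G"
  using disjoint Xle_sub Yle_sub Rel_sub
  unfolding preceq3_def Z_S_def Z_T_def by blast+

lemma pre_sub: "pre \<subseteq> (X \<union> Y) \<times> (X \<union> Y)"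
  by (auto simp: preceq3_def Z_S_def Z_T_def dest: Xle_sub Yle_sub Rel_sub)

text \<open>If y stands for the join of the q below it and x for the meet of the p above it, this is
  the natural meaning of y \<le> x: every such q is below every such p. It treats X and Y
  symmetrically.\<close>

definition cut :: "'a \<Rightarrow> 'a \<Rightarrow> bool" where
  "cut y x \<longleftrightarrow> (\<forall>p\<in>P. \<forall>q\<in>P. (eY G q, y) \<in> Yle G \<longrightarrow> (x, eX G p) \<in> Xle G \<longrightarrow> (q, p) \<in> Ple G)"

text \<open>For fixed p, the condition on all q says that e_Y(p) bounds the e_Y(q) below y, and
  their join is y. In \<open>cut_iff_lower\<close> the quantifier over p is absorbed dually, x being
  the meet of the e_X(p) above it.\<close>

lemma cut_iff_upper:
  assumes "y \<in> Y"
  shows "cut y x \<longleftrightarrow> (\<forall>p\<in>P. (x, eX G p) \<in> Xle G \<longrightarrow> (y, eY G p) \<in> Yle G)"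
proof
  assume "cut y x"
  then show "\<forall>p\<in>P. (x, eX G p) \<in> Xle G \<longrightarrow> (y, eY G p) \<in> Yle G"
    by - (intro ballI impI, rule Yle_dense[OF assms], simp_all add: cut_def eY_iff eY_in)
next
  assume "\<forall>p\<in>P. (x, eX G p) \<in> Xle G \<longrightarrow> (y, eY G p) \<in> Yle G"
  then show "cut y x"
    unfolding cut_def using Yle_trans eY_iff by blast
qed

lemma cut_iff_lower:
  assumes "x \<in> X"
  shows "cut y x \<longleftrightarrow> (\<forall>q\<in>P. (eY G q, y) \<in> Yle G \<longrightarrow> (eX G q, x) \<in> Xle G)"
proof
  assume "cut y x"
  then show "\<forall>q\<in>P. (eY G q, y) \<in> Yle G \<longrightarrow> (eX G q, x) \<in> Xle G"
    by - (intro ballI impI, rule Xle_dense[OF _ assms], simp_all add: cut_def eX_iff eX_in)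
next
  assume "\<forall>q\<in>P. (eY G q, y) \<in> Yle G \<longrightarrow> (eX G q, x) \<in> Xle G"
  then show "cut y x"
    unfolding cut_def using Xle_trans eX_iff by blast
qed

text \<open>If e_Y(q) \<le> y, then e_Y(q) \<le> e_Y(p) for all p in S. This inequality is
  transported through P to e_X(q) \<le> e_X(p), so e_X(q) is a lower bound of e_X[S] and lies below
  m \<le> x. \<open>Z_T_imp_cut\<close> is the dual.\<close>

lemma Z_S_imp_cut:
  assumes "(y, x) \<in> Z_S G"
  shows "cut y x"
proof -
  obtain S m where S: "S \<subseteq> P" "is_meet X (Xle G) (eX G ` S) m" "(m, x) \<in> Xle G"
      "\<forall>p\<in>S. (y, eY G p) \<in> Yle G" and "x \<in> X"
    using assms by (auto simp: Z_S_def)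
  have "(eX G q, x) \<in> Xle G" if q: "q \<in> P" "(eY G q, y) \<in> Yle G" for q
  proof -
    have "(eX G q, eX G p) \<in> Xle G" if "p \<in> S" for p
      using that q S Yle_trans eY_iff eX_iff by blast
    then have "(eX G q, m) \<in> Xle G"
      using S(2) eX_in[OF q(1)] by (auto simp: is_meet_def)
    then show ?thesis
      using S(3) Xle_trans by blast
  qed
  then show ?thesis
    using cut_iff_lower[OF \<open>x \<in> X\<close>] by blast
qed

lemma Z_T_imp_cut:
  assumes "(y, x) \<in> Z_T G"
  shows "cut y x"
proof -
  obtain T j where T: "T \<subseteq> P" "is_join Y (Yle G) (eY G ` T) j" "(y, j) \<in> Yle G"
      "\<forall>q\<in>T. (eX G q, x) \<in> Xle G" and "y \<in> Y"
    using assms by (auto simp: Z_T_def)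
  have "(y, eY G p) \<in> Yle G" if p: "p \<in> P" "(x, eX G p) \<in> Xle G" for p
  proof -
    have "(eY G q, eY G p) \<in> Yle G" if "q \<in> T" for q
      using that p T Xle_trans eY_iff eX_iff by blast
    then have "(j, eY G p) \<in> Yle G"
      using T(2) eY_in[OF p(1)] by (auto simp: is_join_def)
    then show ?thesis
      using T(3) Yle_trans by blast
  qed
  then show ?thesis
    using cut_iff_upper[OF \<open>y \<in> Y\<close>] by blast
qed

lemma cut_imp_Z_S:
  assumes "y \<in> Y" "x \<in> X" "cut y x"
  shows "(y, x) \<in> Z_S G"
proof -
  \<comment> \<open>The canonical choice of S: since e_X is a meet-extension, the meet of e_X[S] is
    x itself, so x also serves as m.\<close>
  let ?S = "{p \<in> P. (x, eX G p) \<in> Xle G}"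
  have "\<forall>p\<in>?S. (y, eY G p) \<in> Yle G"
    using assms cut_iff_upper by blast
  then show ?thesis
    using assms is_meet_eX Xle_refl
    by (auto simp: Z_S_def intro!: exI[of _ ?S] exI[of _ x])
qed

lemma pre_YX:
  assumes "y \<in> Y" "x \<in> X"
  shows "(y, x) \<in> pre \<longleftrightarrow> cut y x"
proof
  assume "(y, x) \<in> pre"
  then have "(y, x) \<in> Z_S G \<union> Z_T G"
    using assms disjoint Xle_sub Yle_sub Rel_sub unfolding preceq3_def by blast
  then show "cut y x"
    using Z_S_imp_cut Z_T_imp_cut by blast
next
  assume "cut y x"
  then show "(y, x) \<in> pre"
    using cut_imp_Z_S assms by (auto simp: preceq3_def)
qed

section \<open>\<open>preceq3\<close> is a preorder identifying the two copies of P\<close>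

lemma pre_XYX:
  assumes "(x1, y) \<in> Rel G" "x2 \<in> X" "cut y x2"
  shows "(x1, x2) \<in> Xle G"
proof (rule Xle_dense)
  \<comment> \<open>By density only the e_X(p) above x2 matter. For these, x1 R y \<le> e_Y(p), and
    R against e_Y(p) falls back to the order of X.\<close>
  fix p assume p: "p \<in> P" "(x2, eX G p) \<in> Xle G"
  then have "(y, eY G p) \<in> Yle G"
    using assms Rel_sub cut_iff_upper by blast
  then show "(x1, eX G p) \<in> Xle G"
    using assms Rel_Yle Rel_eY_D p by blast
qed (use assms Rel_sub in blast)+

lemma pre_YXY:
  assumes "(x, y2) \<in> Rel G" "y1 \<in> Y" "cut y1 x"
  shows "(y1, y2) \<in> Yle G"
proof (rule Yle_dense)
  fix q assume q: "q \<in> P" "(eY G q, y1) \<in> Yle G"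
  then have "(eX G q, x) \<in> Xle G"
    using assms Rel_sub cut_iff_lower by blast
  then show "(eY G q, y2) \<in> Yle G"
    using assms Xle_Rel Rel_eX_D q by blast
qed (use assms Rel_sub in blast)+

lemma cut_mono:
  shows "cut y x \<Longrightarrow> (y', y) \<in> Yle G \<Longrightarrow> cut y' x"
    and "cut y x \<Longrightarrow> (x, x') \<in> Xle G \<Longrightarrow> cut y x'"
  unfolding cut_def using Yle_trans[of _ y' y] Xle_trans[of x x'] by auto

text \<open>Transitivity is checked on the eight ways in which three elements can be placed in X or
  Y. Only XYX and YXY leave a side and return to it, and these rest on density. The remaining mixed
  cases are monotonicity of R or of \<open>cut\<close>.\<close>

lemma preorder_pre: "preorder_on (X \<union> Y) pre"
proof -
  have "(a, c) \<in> pre" if ab: "(a, b) \<in> pre" and bc: "(b, c) \<in> pre" for a b c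
  proof -
    consider (XXX) "a \<in> X" "b \<in> X" "c \<in> X"
      | (XXY) "a \<in> X" "b \<in> X" "c \<in> Y"
      | (XYX) "a \<in> X" "b \<in> Y" "c \<in> X"
      | (XYY) "a \<in> X" "b \<in> Y" "c \<in> Y"
      | (YXX) "a \<in> Y" "b \<in> X" "c \<in> X"
      | (YXY) "a \<in> Y" "b \<in> X" "c \<in> Y"
      | (YYX) "a \<in> Y" "b \<in> Y" "c \<in> X"
      | (YYY) "a \<in> Y" "b \<in> Y" "c \<in> Y"
      using subsetD[OF pre_sub ab] subsetD[OF pre_sub bc] by auto
    then show ?thesis
    proof cases
      case XXX
      with ab bc show ?thesis
        using Xle_trans[of a b c] by (simp add: pre_XX)
    next
      case XXY
      with ab bc show ?thesis
        using Xle_Rel[of a b c] by (simp add: pre_XX pre_XY)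
    next
      case XYX
      with ab bc show ?thesis
        using pre_XYX[of a b c] by (simp add: pre_XX pre_XY pre_YX)
    next
      case XYY
      with ab bc show ?thesis
        using Rel_Yle[of a b c] by (simp add: pre_XY pre_YY)
    next
      case YXX
      with ab bc show ?thesis
        using cut_mono(2)[of a b c] by (simp add: pre_XX pre_YX)
    next
      case YXY
      with ab bc show ?thesis
        using pre_YXY[of b c a] by (simp add: pre_XY pre_YX pre_YY)
    next
      case YYX
      with ab bc show ?thesis
        using cut_mono(1)[of b c a] by (simp add: pre_YX pre_YY)
    next
      case YYY
      with ab bc show ?thesis
        using Yle_trans[of a b c] by (simp add: pre_YY)
    qed
  qed
  then have "trans pre"
    by (rule transI)
  moreover have "(z, z) \<in> pre" if "z \<in> X \<union> Y" for z
    using that Xle_refl Yle_refl by (auto simp: preceq3_def)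
  ultimately show ?thesis
    using pre_sub by (auto simp: preorder_on_def refl_on_def)
qed

lemma eX_equiv_eY:
  assumes "p \<in> P"
  shows "quot_map pre (eX G p) = quot_map pre (eY G p)"
proof (rule quot_map_eqI)
  show "trans pre"
    using preorder_pre by (simp add: preorder_on_def)
  show "(eX G p, eY G p) \<in> pre"
    using assms Rel_eX_eY by (auto simp: preceq3_def)
  \<comment> \<open>By \<open>cut_iff_lower\<close> this asks that e_Y(q) \<le> e_Y(p) imply e_X(q)
    \<le> e_X(p); both inequalities mean q \<le> p in P.\<close>
  show "(eY G p, eX G p) \<in> pre"
    using assms by (simp add: pre_YX cut_iff_lower eX_in eY_in eX_iff eY_iff)
qed

section \<open>Preservation of meets from X and joins from Y\<close>

lemma is_meet_pre:
  assumes "S \<subseteq> X" "is_meet X (Xle G) S m"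
  shows "is_meet (X \<union> Y) pre S m"
proof -
  have m: "m \<in> X"
    using assms by (simp add: is_meet_def)
  \<comment> \<open>Lower bounds from X are covered by the hypothesis. A lower bound y from Y is
    represented by the e_X(q) with e_Y(q) \<le> y: each of them is below all of S, hence below
    m.\<close>
  have "(y, m) \<in> pre" if y: "y \<in> Y" "\<forall>s\<in>S. (y, s) \<in> pre" for y
  proof -
    have "(eX G q, m) \<in> Xle G" if q: "q \<in> P" "(eY G q, y) \<in> Yle G" for q
    proof -
      have "(eX G q, s) \<in> Xle G" if "s \<in> S" for s
        using that y q assms(1) cut_iff_lower pre_YX by blast
      then show ?thesis
        using assms(2) eX_in q by (auto simp: is_meet_def)
    qed
    then show ?thesis
      using cut_iff_lower m pre_YX y by blast
  qed
  then show ?thesis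
    using assms m pre_XX by (auto simp: is_meet_def subset_iff)
qed

lemma is_join_pre:
  assumes "S \<subseteq> Y" "is_join Y (Yle G) S j"
  shows "is_join (X \<union> Y) pre S j"
proof -
  have j: "j \<in> Y"
    using assms by (simp add: is_join_def)
  have "(j, x) \<in> pre" if x: "x \<in> X" "\<forall>s\<in>S. (s, x) \<in> pre" for x
  proof -
    have "(j, eY G p) \<in> Yle G" if p: "p \<in> P" "(x, eX G p) \<in> Xle G" for p
    proof -
      have "(s, eY G p) \<in> Yle G" if "s \<in> S" for s
        using that x p assms(1) cut_iff_upper pre_YX by blast
      then show ?thesis
        using assms(2) eY_in p by (auto simp: is_join_def)
    qed
    then show ?thesis
      using cut_iff_upper j pre_YX x by blast
  qed
  then show ?thesis
    using assms j pre_YY by (auto simp: is_join_def subset_iff)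
qed

lemma meet_preserving:
  "completely_meet_preserving X (Xle G) (amalg G pre) (amalg_le G pre) (quot_map pre)"
  unfolding completely_meet_preserving_def amalg_def amalg_le_def
proof (intro allI impI)
  fix S m assume "S \<subseteq> X" "is_meet X (Xle G) S m"
  moreover from this have "m \<in> X"
    by (simp add: is_meet_def)
  ultimately show "is_meet (quot_carrier (X \<union> Y) pre) (quot_le (X \<union> Y) pre)
      (quot_map pre ` S) (quot_map pre m)"
    using is_meet_quot_iff[OF preorder_pre] is_meet_pre by blast
qed

lemma join_preserving:
  "completely_join_preserving Y (Yle G) (amalg G pre) (amalg_le G pre) (quot_map pre)"
  unfolding completely_join_preserving_def amalg_def amalg_le_def
proof (intro allI impI)
  fix S j assume "S \<subseteq> Y" "is_join Y (Yle G) S j"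
  moreover from this have "j \<in> Y"
    by (simp add: is_join_def)
  ultimately show "is_join (quot_carrier (X \<union> Y) pre) (quot_le (X \<union> Y) pre)
      (quot_map pre ` S) (quot_map pre j)"
    using is_join_quot_iff[OF preorder_pre] is_join_pre by blast
qed

section \<open>3-preorders: existence and uniqueness\<close>

lemma order_embedding_amalg:
  assumes "preorder_on (X \<union> Y) r" "A \<subseteq> X \<union> Y"
  shows "order_embedding A le (amalg G r) (amalg_le G r) (quot_map r)
    \<longleftrightarrow> (\<forall>a\<in>A. \<forall>b\<in>A. (a, b) \<in> le \<longleftrightarrow> (a, b) \<in> r)"
  using assms
  by (auto simp: order_embedding_def amalg_def amalg_le_def quot_carrier_eq quot_le_iff subset_iff)

text \<open>The clauses on meets and joins concern subsets of e_X[P] and e_Y[P], so they are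
  instances of the complete preservation shown before.\<close>

lemma three_preorder_pre: "three_preorder G pre"
proof -
  have "is_meet (amalg G pre) (amalg_le G pre) (quot_map pre ` eX G ` S) (quot_map pre x)"
    if "S \<subseteq> P" "is_meet X (Xle G) (eX G ` S) x" for S x
  proof -
    have "eX G ` S \<subseteq> X"
      using that eX_in by auto
    then show ?thesis
      using meet_preserving that by (simp add: completely_meet_preserving_def)
  qed
  moreover have "is_join (amalg G pre) (amalg_le G pre) (quot_map pre ` eY G ` T) (quot_map pre y)"
    if "T \<subseteq> P" "is_join Y (Yle G) (eY G ` T) y" for T y
  proof -
    have "eY G ` T \<subseteq> Y"
      using that eY_in by auto
    then show ?thesis
      using join_preserving that by (simp add: completely_join_preserving_def)
  qed
  moreover have "Xle G \<subseteq> pre" "Yle G \<subseteq> pre"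
    by (auto simp: preceq3_def)
  ultimately show ?thesis
    unfolding three_preorder_def
    by (simp add: preorder_pre pre_XX pre_YY pre_XY eX_equiv_eY order_embedding_amalg)
qed

text \<open>The Y-to-X block is the one that the definition does not prescribe outright. It cannot
  exceed \<open>cut\<close> because Y embeds, and it cannot be smaller because meets of subsets of
  e_X[P] are preserved.\<close>

lemma three_preorder_YX:
  assumes r: "three_preorder G r" and "y \<in> Y" "x \<in> X"
  shows "(y, x) \<in> r \<longleftrightarrow> cut y x"
proof
  have pre: "preorder_on (X \<union> Y) r"
    and YY: "\<forall>a\<in>Y. \<forall>b\<in>Y. (a, b) \<in> Yle G \<longleftrightarrow> (a, b) \<in> r"
    and sub: "Xle G \<subseteq> r" "Yle G \<subseteq> r"
    and eq: "\<forall>p\<in>P. quot_map r (eX G p) = quot_map r (eY G p)"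
    using r by (auto simp: three_preorder_def order_embedding_amalg)
  have tr: "(a, c) \<in> r" if "(a, b) \<in> r" "(b, c) \<in> r" for a b c
    using pre that by (meson preorder_on_def transE)
  show "cut y x" if "(y, x) \<in> r"
    unfolding cut_iff_upper[OF \<open>y \<in> Y\<close>]
  proof (intro ballI impI)
    fix p assume p: "p \<in> P" "(x, eX G p) \<in> Xle G"
    \<comment> \<open>The two images of p are identified in the quotient, so the chain from y over x
      to e_X(p) continues to e_Y(p). The embedding of Y then turns this into an inequality of
      Y.\<close>
    have "(eX G p, eY G p) \<in> r"
      using quot_map_eqD(1)[OF pre] eq eY_in p by blast
    then have "(y, eY G p) \<in> r"
      using that p sub tr by blast
    then show "(y, eY G p) \<in> Yle G"
      using YY \<open>y \<in> Y\<close> eY_in p by blast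
  qed
  show "(y, x) \<in> r" if "cut y x"
  proof -
    \<comment> \<open>x is the meet of e_X[S], and this meet persists in r. Up to the identification
      of e_X(p) with e_Y(p), \<open>cut\<close> makes y a lower bound of e_X[S], hence y is below x
      in r.\<close>
    define S where "S = {p \<in> P. (x, eX G p) \<in> Xle G}"
    have S: "eX G ` S \<subseteq> X \<union> Y"
      using eX_in by (auto simp: S_def)
    have "S \<subseteq> P" "is_meet X (Xle G) (eX G ` S) x"
      using is_meet_eX \<open>x \<in> X\<close> by (auto simp: S_def)
    then have "is_meet (amalg G r) (amalg_le G r) (quot_map r ` eX G ` S) (quot_map r x)"
      using r by (simp add: three_preorder_def)
    then have "is_meet (X \<union> Y) r (eX G ` S) x"
      using is_meet_quot_iff[OF pre S, of x] \<open>x \<in> X\<close> by (simp add: amalg_def amalg_le_def)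
    moreover have "(y, eX G p) \<in> r" if "p \<in> S" for p
    proof -
      have p: "p \<in> P" "(x, eX G p) \<in> Xle G"
        using that by (auto simp: S_def)
      have "(y, eY G p) \<in> r"
        using \<open>cut y x\<close> cut_iff_upper[OF \<open>y \<in> Y\<close>] p sub by blast
      moreover have "(eY G p, eX G p) \<in> r"
        using quot_map_eqD(2)[OF pre] eq eY_in p by blast
      ultimately show ?thesis
        using tr by blast
    qed
    ultimately show ?thesis
      using \<open>y \<in> Y\<close> by (auto simp: is_meet_def)
  qed
qed

text \<open>As \<open>preorder_on\<close> confines r to X \<union> Y, its four blocks determine it:
  two are fixed by the embeddings, one by R, and the last by
  \<open>three_preorder_YX\<close>.\<close>

lemma three_preorder_unique:
  assumes r: "three_preorder G r"
  shows "r = pre"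
proof -
  have pre: "preorder_on (X \<union> Y) r"
    and XX: "\<forall>a\<in>X. \<forall>b\<in>X. (a, b) \<in> Xle G \<longleftrightarrow> (a, b) \<in> r"
    and YY: "\<forall>a\<in>Y. \<forall>b\<in>Y. (a, b) \<in> Yle G \<longleftrightarrow> (a, b) \<in> r"
    and XY: "\<forall>a\<in>X. \<forall>b\<in>Y. (a, b) \<in> r \<longleftrightarrow> (a, b) \<in> Rel G"
    using r by (auto simp: three_preorder_def order_embedding_amalg)
  have sub: "r \<subseteq> (X \<union> Y) \<times> (X \<union> Y)"
    using pre by (simp add: preorder_on_def)
  have eq: "(a, b) \<in> r \<longleftrightarrow> (a, b) \<in> pre" if "a \<in> X \<union> Y" "b \<in> X \<union> Y" for a b
    using that XX YY XY three_preorder_YX[OF r]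
    by (auto simp: pre_XX pre_YY pre_XY pre_YX)
  show ?thesis
  proof (rule set_eqI)
    fix z show "z \<in> r \<longleftrightarrow> z \<in> pre"
      using subsetD[OF sub, of z] subsetD[OF pre_sub, of z] eq by (cases z) auto
  qed
qed

section \<open>Generation of the quotient by the images of X and Y\<close>

lemma join_generated: "join_generated_by (amalg G pre) (amalg_le G pre) (quot_map pre ` X)"
proof -
  have "\<exists>S\<subseteq>quot_map pre ` X. is_join (amalg G pre) (amalg_le G pre) S (quot_map pre z)"
    if "z \<in> X \<union> Y" for z
  proof (cases "z \<in> X")
    case True
    then have "is_join (X \<union> Y) pre {z} z"
      using Xle_refl by (auto simp: is_join_def pre_XX)
    then show ?thesis
      using is_join_quot_iff[OF preorder_pre, of "{z}" z] True
      unfolding amalg_def amalg_le_def by (intro exI[of _ "quot_map pre ` {z}"]) auto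
  next
    case False
    then have z: "z \<in> Y"
      using that by blast
    \<comment> \<open>z is the join of e_Y[T], and \<iota>_Y preserves this join. Identifying e_Y(q)
      with e_X(q) moves the joined set into \<iota>_X[X].\<close>
    define T where "T = {q \<in> P. (eY G q, z) \<in> Yle G}"
    have "is_join Y (Yle G) (eY G ` T) z" "eY G ` T \<subseteq> Y"
      using is_join_eY z eY_in by (auto simp: T_def)
    then have "is_join (amalg G pre) (amalg_le G pre) (quot_map pre ` eY G ` T) (quot_map pre z)"
      using join_preserving by (simp add: completely_join_preserving_def)
    moreover have "quot_map pre ` eY G ` T = quot_map pre ` eX G ` T"
      using eX_equiv_eY by (force simp: T_def image_image)
    ultimately show ?thesis
      using eX_in by (intro exI[of _ "quot_map pre ` eX G ` T"]) (auto simp: T_def)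
  qed
  then show ?thesis
    by (auto simp: join_generated_by_def amalg_def quot_carrier_eq)
qed

lemma meet_generated: "meet_generated_by (amalg G pre) (amalg_le G pre) (quot_map pre ` Y)"
proof -
  have "\<exists>S\<subseteq>quot_map pre ` Y. is_meet (amalg G pre) (amalg_le G pre) S (quot_map pre z)"
    if "z \<in> X \<union> Y" for z
  proof (cases "z \<in> Y")
    case True
    then have "is_meet (X \<union> Y) pre {z} z"
      using Yle_refl by (auto simp: is_meet_def pre_YY)
    then show ?thesis
      using is_meet_quot_iff[OF preorder_pre, of "{z}" z] True
      unfolding amalg_def amalg_le_def by (intro exI[of _ "quot_map pre ` {z}"]) auto
  next
    case False
    then have z: "z \<in> X"
      using that by blast
    \<comment> \<open>Dually, z is the meet of e_X[S], \<iota>_X preserves it, and the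
      identification moves the set into \<iota>_Y[Y].\<close>
    define S where "S = {p \<in> P. (z, eX G p) \<in> Xle G}"
    have "is_meet X (Xle G) (eX G ` S) z" "eX G ` S \<subseteq> X"
      using is_meet_eX z eX_in by (auto simp: S_def)
    then have "is_meet (amalg G pre) (amalg_le G pre) (quot_map pre ` eX G ` S) (quot_map pre z)"
      using meet_preserving by (simp add: completely_meet_preserving_def)
    moreover have "quot_map pre ` eX G ` S = quot_map pre ` eY G ` S"
      using eX_equiv_eY by (force simp: S_def image_image)
    ultimately show ?thesis
      using eY_in by (intro exI[of _ "quot_map pre ` eY G ` S"]) (auto simp: S_def)
  qed
  then show ?thesis
    by (auto simp: meet_generated_by_def amalg_def quot_carrier_eq)
qed

end

theorem theorem4p12:
  fixes G :: "('p, 'a) polarity"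
  assumes "galois_polarity G"
  shows "completely_meet_preserving (Xcar G) (Xle G)
           (amalg G (preceq3 G)) (amalg_le G (preceq3 G)) (quot_map (preceq3 G)) \<and>
         completely_join_preserving (Ycar G) (Yle G)
           (amalg G (preceq3 G)) (amalg_le G (preceq3 G)) (quot_map (preceq3 G)) \<and>
         (\<forall>r. three_preorder G r \<longleftrightarrow> r = preceq3 G) \<and>
         join_generated_by (amalg G (preceq3 G)) (amalg_le G (preceq3 G))
           (quot_map (preceq3 G) ` Xcar G) \<and>
         meet_generated_by (amalg G (preceq3 G)) (amalg_le G (preceq3 G))
           (quot_map (preceq3 G) ` Ycar G)"
proof -
  interpret galois G
    using assms by unfold_locales
  show ?thesis
    using meet_preserving join_preserving three_preorder_pre three_preorder_unique
      join_generated meet_generated by blast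
qed

end
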